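(* For every set $X$ and all $R,S\subseteq X\times X$ the following equalities hold: $$-\widetilde R=\widetilde{-R},\qquad \widetilde{R\cup S}=\widetilde R\cup\widetilde S,\qquad \widetilde{R\cap S}=\widetilde R\cap\widetilde S,$$ $$(R^* )^{-1}=(R^{-1})^*,\qquad (R\cup S)^*=R^*\cup S^*,\qquad (R\circ S)^*=R^*\circ S^*.$$ Moreover, the following inclusions hold: $$-(R^* )\subseteq(-R)^*,\qquad (R\cap S)^*\subseteq R^*\cap S^*,\qquad \widetilde R\circ\widetilde S\subseteq\widetilde{R\circ S},$$ and none of these three inclusions can, in general, be replaced by an equality (for each of them there are $X$ and $R,S\subseteq X\times X$ for which it is strict). Finally, $(\widetilde R)^{-1}$ and $\widetilde{R^{-1}}$ are, in general, $\subseteq$-incomparable: there are $X$ and $R\subseteq X\times X$ such that neither of $(\widetilde R)^{-1}$, $\widetilde{R^{-1}}$ is included in the other.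
   Context: $\beta X$ denotes the set of ultrafilters over the set $X$. For $R\subseteq X\times X$ the relations $\widetilde R,R^*\subseteq\beta X\times\beta X$ are defined, for $u,v\in\beta X$, by $$\widetilde R(u,v)\iff\{x:\{y:R(x,y)\}\in v\}\in u,$$ $$R^*(u,v)\iff(\forall S\in v)\ \{x:(\exists y\in S)\,R(x,y)\}\in u.$$ The sign $-$ denotes complement: $-R=(X\times X)\setminus R$ for $R\subseteq X\times X$, and $-Q=(\beta X\times\beta X)\setminus Q$ for a relation $Q$ on $\beta X$. For a relation $Q$, $Q^{-1}=\{(b,a):(a,b)\in Q\}$. Composition of relations: $(a,b)\in R\circ S$ iff there is $c$ with $(a,c)\in S$ and $(c,b)\in R$. *)

theory Defs
  imports Main
begin

text \<open>
  Ultrafilters are taken over a carrier set \<open>X\<close> (possibly empty, possibly a proper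
  subset of its type): families of subsets of \<open>X\<close>, principal ultrafilters included.
\<close>

definition ultrafilter_on :: "'a set \<Rightarrow> 'a set set \<Rightarrow> bool" where
  "ultrafilter_on X u \<longleftrightarrow>
     u \<subseteq> Pow X \<and> X \<in> u \<and> {} \<notin> u \<and>
     (\<forall>A\<in>u. \<forall>B\<in>u. A \<inter> B \<in> u) \<and>
     (\<forall>A\<in>u. \<forall>B. A \<subseteq> B \<and> B \<subseteq> X \<longrightarrow> B \<in> u) \<and>
     (\<forall>A. A \<subseteq> X \<longrightarrow> A \<in> u \<or> X - A \<in> u)"

definition ultrafilters :: "'a set \<Rightarrow> 'a set set set" where
  "ultrafilters X = {u. ultrafilter_on X u}"

definition tilde_ext :: "'a set \<Rightarrow> ('a \<times> 'a) set \<Rightarrow> ('a set set \<times> 'a set set) set" where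
  "tilde_ext X R =
     {(u, v) \<in> ultrafilters X \<times> ultrafilters X.
        {x \<in> X. {y \<in> X. (x, y) \<in> R} \<in> v} \<in> u}"

definition star_ext :: "'a set \<Rightarrow> ('a \<times> 'a) set \<Rightarrow> ('a set set \<times> 'a set set) set" where
  "star_ext X R =
     {(u, v) \<in> ultrafilters X \<times> ultrafilters X.
        \<forall>S\<in>v. {x \<in> X. \<exists>y\<in>S. (x, y) \<in> R} \<in> u}"

text \<open>
  Composition in functional order: \<open>(a, b) \<in> R \<circ>\<^sub>r S\<close> iff \<open>(a, c) \<in> S\<close> and
  \<open>(c, b) \<in> R\<close> for some \<open>c\<close>.  The library's \<^const>\<open>relcomp\<close> takes its arguments
  in the opposite order.
\<close>

abbreviation rel_comp :: "('b \<times> 'c) set \<Rightarrow> ('a \<times> 'b) set \<Rightarrow> ('a \<times> 'c) set"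
    (infixl \<open>\<circ>\<^sub>r\<close> 75) where
  "R \<circ>\<^sub>r S \<equiv> S O R"

end

theory Submission
  imports Defs
begin

text \<open>
  Membership in an ultrafilter commutes with all Boolean operations, and
  \<^const>\<open>tilde_ext\<close> is a twofold ultrafilter quantifier; this gives its three equalities.
  For \<^const>\<open>star_ext\<close> everything rests on a symmetric description
  (lemma \<open>star_ext_iff\<close>): \<open>(u, v)\<close> lies in \<open>R\<^sup>*\<close> iff \<open>R\<close> meets \<open>A \<times> B\<close> for all
  \<open>A \<in> u\<close> and \<open>B \<in> v\<close>. Converse, union, complement and intersection are then read off. For the
  composition, the intermediate ultrafilter is any one containing the sets \<open>S[A] \<inter> R\<inverse>[B]\<close>
  with \<open>A \<in> u\<close> and \<open>B \<in> v\<close>; these form a filter base, so the ultrafilter lemma applies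
  (\<open>ultrafilter_extending_base\<close>).

  All counterexamples live on the natural numbers and use an ultrafilter \<open>u\<close> with no finite
  member. The pair \<open>(u, u)\<close> lies in both \<open>Id\<^sup>*\<close> and \<open>(-Id)\<^sup>*\<close>, which makes the
  inclusions for complement and intersection strict. It lies in the tilde extension of the full
  relation, which is its own composition with \<open>Id\<close>; but \<open>u\<close> is related by the tilde extension
  of \<open>Id\<close> to no ultrafilter at all. Finally, the tilde extension of
  \<open><\<close> contains \<open>(u, u)\<close> while that of \<open>>\<close> does not; the relation \<open>x < y \<longleftrightarrow> even x\<close> behaves
  like \<open><\<close> for ultrafilters containing the even numbers and like \<open>\<ge>\<close> for those containing the
  odd numbers, so for it neither inclusion between the converse of the extension and the
  extension of the converse holds.
\<close>

section \<open>Ultrafilters on a carrier set\<close>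

lemma ultrafilter_on_subset: "ultrafilter_on X u \<Longrightarrow> A \<in> u \<Longrightarrow> A \<subseteq> X"
  by (auto simp: ultrafilter_on_def)

lemma ultrafilter_on_carrier: "ultrafilter_on X u \<Longrightarrow> X \<in> u"
  by (auto simp: ultrafilter_on_def)

lemma ultrafilter_on_nonempty: "ultrafilter_on X u \<Longrightarrow> A \<in> u \<Longrightarrow> A \<noteq> {}"
  by (auto simp: ultrafilter_on_def)

lemma ultrafilter_on_Int: "ultrafilter_on X u \<Longrightarrow> A \<in> u \<Longrightarrow> B \<in> u \<Longrightarrow> A \<inter> B \<in> u"
  by (auto simp: ultrafilter_on_def)

lemma ultrafilter_on_mono:
  "ultrafilter_on X u \<Longrightarrow> A \<in> u \<Longrightarrow> A \<subseteq> B \<Longrightarrow> B \<subseteq> X \<Longrightarrow> B \<in> u"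
  by (auto simp: ultrafilter_on_def)

lemma ultrafilter_on_Diff_iff:
  assumes "ultrafilter_on X u" "A \<subseteq> X"
  shows "X - A \<in> u \<longleftrightarrow> A \<notin> u"
proof -
  have "A \<in> u \<Longrightarrow> X - A \<in> u \<Longrightarrow> False"
    using ultrafilter_on_Int[OF assms(1)] ultrafilter_on_nonempty[OF assms(1)]
    by (metis Diff_disjoint)
  moreover have "A \<in> u \<or> X - A \<in> u"
    using assms by (simp add: ultrafilter_on_def)
  ultimately show ?thesis by blast
qed

lemma ultrafilter_on_Int_iff:
  assumes "ultrafilter_on X u" "A \<subseteq> X" "B \<subseteq> X"
  shows "A \<inter> B \<in> u \<longleftrightarrow> A \<in> u \<and> B \<in> u"
  using ultrafilter_on_Int[OF assms(1)] ultrafilter_on_mono[OF assms(1)] assms(2,3)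
  by (metis inf_le1 inf_le2)

lemma ultrafilter_on_Un_iff:
  assumes "ultrafilter_on X u" "A \<subseteq> X" "B \<subseteq> X"
  shows "A \<union> B \<in> u \<longleftrightarrow> A \<in> u \<or> B \<in> u"
proof -
  have "A \<union> B \<in> u \<longleftrightarrow> (X - A) \<inter> (X - B) \<notin> u"
    using ultrafilter_on_Diff_iff[OF assms(1), of "A \<union> B"] assms(2,3)
    by (metis Diff_Un Un_least)
  also have "\<dots> \<longleftrightarrow> A \<in> u \<or> B \<in> u"
    using ultrafilter_on_Int_iff[OF assms(1), of "X - A" "X - B"]
      ultrafilter_on_Diff_iff[OF assms(1)] assms(2,3) by auto
  finally show ?thesis .
qed

lemma ultrafilter_on_mem_iff_meets:
  assumes "ultrafilter_on X u" "A \<subseteq> X"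
  shows "A \<in> u \<longleftrightarrow> (\<forall>B\<in>u. A \<inter> B \<noteq> {})"
proof
  assume "A \<in> u"
  then show "\<forall>B\<in>u. A \<inter> B \<noteq> {}"
    using ultrafilter_on_Int[OF assms(1)] ultrafilter_on_nonempty[OF assms(1)] by blast
next
  assume meets: "\<forall>B\<in>u. A \<inter> B \<noteq> {}"
  have "X - A \<notin> u"
    using meets by auto
  then show "A \<in> u"
    using ultrafilter_on_Diff_iff[OF assms] by blast
qed

text \<open>A proper filter of subsets of \<open>X\<close>.\<close>

definition proper_filter_on :: "'a set \<Rightarrow> 'a set set \<Rightarrow> bool" where
  "proper_filter_on X u \<longleftrightarrow>
     u \<subseteq> Pow X \<and> X \<in> u \<and> {} \<notin> u \<and>
     (\<forall>A\<in>u. \<forall>B\<in>u. A \<inter> B \<in> u) \<and>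
     (\<forall>A\<in>u. \<forall>B. A \<subseteq> B \<and> B \<subseteq> X \<longrightarrow> B \<in> u)"

lemma proper_filter_onI:
  assumes "\<And>A. A \<in> u \<Longrightarrow> A \<subseteq> X" "X \<in> u" "{} \<notin> u"
    and "\<And>A B. A \<in> u \<Longrightarrow> B \<in> u \<Longrightarrow> A \<inter> B \<in> u"
    and "\<And>A B. A \<in> u \<Longrightarrow> A \<subseteq> B \<Longrightarrow> B \<subseteq> X \<Longrightarrow> B \<in> u"
  shows "proper_filter_on X u"
proof -
  have "u \<subseteq> Pow X" using assms(1) by auto
  then show ?thesis using assms(2-5) by (simp add: proper_filter_on_def)
qed

lemma proper_filter_onD:
  assumes "proper_filter_on X u"
  shows "A \<in> u \<Longrightarrow> A \<subseteq> X" and "X \<in> u" and "{} \<notin> u"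
    and "A \<in> u \<Longrightarrow> B \<in> u \<Longrightarrow> A \<inter> B \<in> u"
    and "A \<in> u \<Longrightarrow> A \<subseteq> B \<Longrightarrow> B \<subseteq> X \<Longrightarrow> B \<in> u"
proof -
  show "A \<subseteq> X" if "A \<in> u"
    using assms that by (auto simp: proper_filter_on_def)
  show "X \<in> u" "{} \<notin> u"
    using assms by (simp_all add: proper_filter_on_def)
  show "A \<inter> B \<in> u" if "A \<in> u" "B \<in> u"
    using assms that by (simp add: proper_filter_on_def)
  show "B \<in> u" if "A \<in> u" "A \<subseteq> B" "B \<subseteq> X"
    using assms that by (auto simp: proper_filter_on_def)
qed

lemma proper_filter_on_upward_closure:
  assumes sub: "\<B> \<subseteq> Pow X" and ne: "\<B> \<noteq> {}" and empty: "{} \<notin> \<B>"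
    and dir: "\<And>A B. A \<in> \<B> \<Longrightarrow> B \<in> \<B> \<Longrightarrow> \<exists>C\<in>\<B>. C \<subseteq> A \<inter> B"
  shows "proper_filter_on X {C. C \<subseteq> X \<and> (\<exists>b\<in>\<B>. b \<subseteq> C)}" (is "proper_filter_on X ?u")
proof (rule proper_filter_onI)
  show "\<And>A. A \<in> ?u \<Longrightarrow> A \<subseteq> X" "{} \<notin> ?u"
    using empty by auto
  show "X \<in> ?u"
    using sub ne by blast
  show "A \<inter> B \<in> ?u" if AB: "A \<in> ?u" "B \<in> ?u" for A B
  proof -
    from AB obtain a b where ab: "a \<in> \<B>" "a \<subseteq> A" "b \<in> \<B>" "b \<subseteq> B" by blast
    with dir[of a b] obtain c where "c \<in> \<B>" "c \<subseteq> a \<inter> b" by blast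
    with ab have "c \<in> \<B>" "c \<subseteq> A \<inter> B" by auto
    moreover have "A \<inter> B \<subseteq> X" using AB by auto
    ultimately show ?thesis by auto
  qed
  show "B \<in> ?u" if "A \<in> ?u" "A \<subseteq> B" "B \<subseteq> X" for A B
    using that by blast
qed

lemma proper_filter_on_Union_chain:
  assumes filt: "\<And>u. u \<in> \<C> \<Longrightarrow> proper_filter_on X u" and ne: "\<C> \<noteq> {}"
    and chain: "\<And>u v. u \<in> \<C> \<Longrightarrow> v \<in> \<C> \<Longrightarrow> u \<subseteq> v \<or> v \<subseteq> u"
  shows "proper_filter_on X (\<Union>\<C>)"
proof (rule proper_filter_onI)
  show "\<And>A. A \<in> \<Union>\<C> \<Longrightarrow> A \<subseteq> X" "X \<in> \<Union>\<C>" "{} \<notin> \<Union>\<C>"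
    using proper_filter_onD(1-3)[OF filt] ne by auto
  show "A \<inter> B \<in> \<Union>\<C>" if "A \<in> \<Union>\<C>" "B \<in> \<Union>\<C>" for A B
  proof -
    from that obtain u v where "u \<in> \<C>" "v \<in> \<C>" "A \<in> u" "B \<in> v" by blast
    with chain[of u v] obtain w where "w \<in> \<C>" "A \<in> w" "B \<in> w" by blast
    then show ?thesis using proper_filter_onD(4)[OF filt] by blast
  qed
  show "B \<in> \<Union>\<C>" if "A \<in> \<Union>\<C>" "A \<subseteq> B" "B \<subseteq> X" for A B
    using that proper_filter_onD(5)[OF filt] by blast
qed

lemma ultrafilter_on_if_maximal:
  assumes filt: "proper_filter_on X u"
    and max: "\<And>v. proper_filter_on X v \<Longrightarrow> u \<subseteq> v \<Longrightarrow> v = u"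
  shows "ultrafilter_on X u"
proof -
  note filtD = proper_filter_onD[OF filt]
  have "A \<in> u \<or> X - A \<in> u" if A: "A \<subseteq> X" for A
  proof (rule disjCI)
    assume notin: "X - A \<notin> u"
    let ?\<B> = "(\<lambda>C. C \<inter> A) ` u"
    let ?v = "{C. C \<subseteq> X \<and> (\<exists>b\<in>?\<B>. b \<subseteq> C)}"
    \<comment> \<open>If \<open>C \<inter> A\<close> were empty, then \<open>C \<subseteq> X - A\<close> would force \<open>X - A \<in> u\<close>.\<close>
    have "C \<inter> A \<noteq> {}" if "C \<in> u" for C
    proof
      assume "C \<inter> A = {}"
      then have "C \<subseteq> X - A" using filtD(1)[OF that] by blast
      from filtD(5)[OF that this] notin show False by blast
    qed
    then have "{} \<notin> ?\<B>" by auto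
    moreover have "\<exists>c\<in>?\<B>. c \<subseteq> a \<inter> b" if ab: "a \<in> ?\<B>" "b \<in> ?\<B>" for a b
    proof -
      from ab obtain C D where CD: "C \<in> u" "D \<in> u" "a = C \<inter> A" "b = D \<inter> A" by blast
      then have "C \<inter> D \<in> u" using filtD(4) by blast
      then have "C \<inter> D \<inter> A \<in> ?\<B>" by (rule imageI)
      moreover have "C \<inter> D \<inter> A \<subseteq> a \<inter> b" using CD by auto
      ultimately show ?thesis by (rule rev_bexI)
    qed
    moreover have "?\<B> \<subseteq> Pow X" "?\<B> \<noteq> {}"
      using filtD(2) A by auto
    ultimately have "proper_filter_on X ?v"
      by (intro proper_filter_on_upward_closure) auto
    moreover have "u \<subseteq> ?v"
      using filtD(1) by blast
    ultimately have "?v = u" by (rule max)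
    moreover have "A \<in> ?v"
      using filtD(2) A by blast
    ultimately show "A \<in> u" by blast
  qed
  then show ?thesis
    using filt by (simp add: ultrafilter_on_def proper_filter_on_def)
qed

text \<open>The ultrafilter lemma, for a filter base.\<close>

lemma ultrafilter_extending_base:
  assumes sub: "\<B> \<subseteq> Pow X" and ne: "\<B> \<noteq> {}" and empty: "{} \<notin> \<B>"
    and dir: "\<And>A B. A \<in> \<B> \<Longrightarrow> B \<in> \<B> \<Longrightarrow> \<exists>C\<in>\<B>. C \<subseteq> A \<inter> B"
  obtains u where "ultrafilter_on X u" "\<B> \<subseteq> u"
proof -
  let ?\<F> = "{u. proper_filter_on X u \<and> \<B> \<subseteq> u}"
  let ?w = "{C. C \<subseteq> X \<and> (\<exists>b\<in>\<B>. b \<subseteq> C)}"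
  have "?w \<in> ?\<F>"
    using proper_filter_on_upward_closure[OF assms] sub by blast
  moreover have "\<Union>\<C> \<in> ?\<F>" if "\<C> \<noteq> {}" "subset.chain ?\<F> \<C>" for \<C>
  proof -
    have "proper_filter_on X u" and extends: "\<B> \<subseteq> u" if "u \<in> \<C>" for u
      using that \<open>subset.chain ?\<F> \<C>\<close> unfolding subset_chain_def by auto
    moreover have "u \<subseteq> v \<or> v \<subseteq> u" if "u \<in> \<C>" "v \<in> \<C>" for u v
      using that \<open>subset.chain ?\<F> \<C>\<close> unfolding subset_chain_def by auto
    ultimately have "proper_filter_on X (\<Union>\<C>)"
      using \<open>\<C> \<noteq> {}\<close> by (intro proper_filter_on_Union_chain) auto
    moreover from \<open>\<C> \<noteq> {}\<close> obtain u where "u \<in> \<C>" by auto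
    then have "\<B> \<subseteq> \<Union>\<C>"
      using extends[of u] by auto
    ultimately show ?thesis by simp
  qed
  ultimately have "\<exists>u\<in>?\<F>. \<forall>v\<in>?\<F>. u \<subseteq> v \<longrightarrow> v = u"
    by (intro subset_Zorn_nonempty) auto
  then obtain u where u: "proper_filter_on X u" "\<B> \<subseteq> u"
    and max: "\<And>v. proper_filter_on X v \<Longrightarrow> \<B> \<subseteq> v \<Longrightarrow> u \<subseteq> v \<Longrightarrow> v = u"
    by auto
  have "ultrafilter_on X u"
  proof (rule ultrafilter_on_if_maximal[OF u(1)])
    show "v = u" if "proper_filter_on X v" "u \<subseteq> v" for v
      using that(1) subset_trans[OF u(2) that(2)] that(2) by (rule max)
  qed
  then show thesis using u(2) by (rule that)
qed

text \<open>A free ultrafilter is obtained in the form used below: it avoids every finite set.\<close>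

lemma free_ultrafilter:
  assumes "infinite (A :: 'a set)"
  obtains u where "ultrafilter_on UNIV u" "A \<in> u" "\<And>F. finite F \<Longrightarrow> F \<notin> u"
proof -
  let ?\<B> = "{A - F | F. finite F}"
  have "{} \<notin> ?\<B>"
    using assms by (auto simp: finite_subset)
  moreover have "\<exists>C\<in>?\<B>. C \<subseteq> D \<inter> E" if "D \<in> ?\<B>" "E \<in> ?\<B>" for D E
  proof -
    from that obtain F G where "finite F" "D = A - F" "finite G" "E = A - G" by blast
    then have "A - (F \<union> G) \<in> ?\<B>" "A - (F \<union> G) \<subseteq> D \<inter> E" by auto
    then show ?thesis by blast
  qed
  moreover have "?\<B> \<subseteq> Pow UNIV" "?\<B> \<noteq> {}" by auto
  ultimately obtain u where u: "ultrafilter_on UNIV u" "?\<B> \<subseteq> u"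
    by (rule_tac ultrafilter_extending_base[of ?\<B> UNIV]) auto
  have "A - {} \<in> u"
    using u(2) by blast
  moreover have "F \<notin> u" if "finite F" for F
  proof -
    have "A - F \<in> u" using u(2) that by blast
    then have "- F \<in> u"
      by (rule ultrafilter_on_mono[OF u(1)]) auto
    then show ?thesis
      using ultrafilter_on_Diff_iff[OF u(1), of F] by (auto simp: Compl_eq_Diff_UNIV)
  qed
  ultimately show thesis
    using u(1) that by simp
qed

section \<open>The tilde extension\<close>

lemma tilde_ext_iff:
  "(u, v) \<in> tilde_ext X R \<longleftrightarrow>
     ultrafilter_on X u \<and> ultrafilter_on X v \<and> {x \<in> X. {y \<in> X. (x, y) \<in> R} \<in> v} \<in> u"
  unfolding tilde_ext_def ultrafilters_def by auto

lemma tilde_ext_Compl: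
  "ultrafilters X \<times> ultrafilters X - tilde_ext X R = tilde_ext X (X \<times> X - R)"
proof -
  have "{x \<in> X. {y \<in> X. (x, y) \<in> X \<times> X - R} \<in> v} \<in> u \<longleftrightarrow>
        {x \<in> X. {y \<in> X. (x, y) \<in> R} \<in> v} \<notin> u"
    if u: "ultrafilter_on X u" and v: "ultrafilter_on X v" for u v
  proof -
    have "{y \<in> X. (x, y) \<in> X \<times> X - R} \<in> v \<longleftrightarrow> {y \<in> X. (x, y) \<in> R} \<notin> v" if "x \<in> X" for x
    proof -
      have "{y \<in> X. (x, y) \<in> X \<times> X - R} = X - {y \<in> X. (x, y) \<in> R}"
        using that by auto
      then show ?thesis
        using ultrafilter_on_Diff_iff[OF v, of "{y \<in> X. (x, y) \<in> R}"] by auto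
    qed
    then have "{x \<in> X. {y \<in> X. (x, y) \<in> X \<times> X - R} \<in> v} =
               X - {x \<in> X. {y \<in> X. (x, y) \<in> R} \<in> v}"
      by auto
    then show ?thesis
      using ultrafilter_on_Diff_iff[OF u, of "{x \<in> X. {y \<in> X. (x, y) \<in> R} \<in> v}"] by auto
  qed
  then show ?thesis
    unfolding tilde_ext_def ultrafilters_def by blast
qed

lemma tilde_ext_Un: "tilde_ext X (R \<union> S) = tilde_ext X R \<union> tilde_ext X S"
proof -
  have "{x \<in> X. {y \<in> X. (x, y) \<in> R \<union> S} \<in> v} \<in> u \<longleftrightarrow>
        {x \<in> X. {y \<in> X. (x, y) \<in> R} \<in> v} \<in> u \<or> {x \<in> X. {y \<in> X. (x, y) \<in> S} \<in> v} \<in> u"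
    if u: "ultrafilter_on X u" and v: "ultrafilter_on X v" for u v
  proof -
    have "{y \<in> X. (x, y) \<in> R \<union> S} = {y \<in> X. (x, y) \<in> R} \<union> {y \<in> X. (x, y) \<in> S}" for x
      by blast
    then have "{x \<in> X. {y \<in> X. (x, y) \<in> R \<union> S} \<in> v} =
        {x \<in> X. {y \<in> X. (x, y) \<in> R} \<in> v} \<union> {x \<in> X. {y \<in> X. (x, y) \<in> S} \<in> v}"
      using ultrafilter_on_Un_iff[OF v] by auto
    then show ?thesis
      using ultrafilter_on_Un_iff[OF u] by auto
  qed
  then show ?thesis
    unfolding tilde_ext_def ultrafilters_def by blast
qed

lemma tilde_ext_Int: "tilde_ext X (R \<inter> S) = tilde_ext X R \<inter> tilde_ext X S"
proof -
  have "{x \<in> X. {y \<in> X. (x, y) \<in> R \<inter> S} \<in> v} \<in> u \<longleftrightarrow>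
        {x \<in> X. {y \<in> X. (x, y) \<in> R} \<in> v} \<in> u \<and> {x \<in> X. {y \<in> X. (x, y) \<in> S} \<in> v} \<in> u"
    if u: "ultrafilter_on X u" and v: "ultrafilter_on X v" for u v
  proof -
    have "{y \<in> X. (x, y) \<in> R \<inter> S} = {y \<in> X. (x, y) \<in> R} \<inter> {y \<in> X. (x, y) \<in> S}" for x
      by blast
    then have "{x \<in> X. {y \<in> X. (x, y) \<in> R \<inter> S} \<in> v} =
        {x \<in> X. {y \<in> X. (x, y) \<in> R} \<in> v} \<inter> {x \<in> X. {y \<in> X. (x, y) \<in> S} \<in> v}"
      using ultrafilter_on_Int_iff[OF v] by auto
    then show ?thesis
      using ultrafilter_on_Int_iff[OF u] by auto
  qed
  then show ?thesis
    unfolding tilde_ext_def ultrafilters_def by blast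
qed

lemma tilde_ext_comp: "tilde_ext X R \<circ>\<^sub>r tilde_ext X S \<subseteq> tilde_ext X (R \<circ>\<^sub>r S)"
proof (rule subrelI)
  fix u v assume "(u, v) \<in> tilde_ext X R \<circ>\<^sub>r tilde_ext X S"
  then obtain w where uw: "(u, w) \<in> tilde_ext X S" and wv: "(w, v) \<in> tilde_ext X R" by blast
  then have u: "ultrafilter_on X u" and v: "ultrafilter_on X v" and w: "ultrafilter_on X w"
    and A: "{x \<in> X. {y \<in> X. (x, y) \<in> S} \<in> w} \<in> u"
    and B: "{y \<in> X. {z \<in> X. (y, z) \<in> R} \<in> v} \<in> w"
    unfolding tilde_ext_iff by auto
  have "{z \<in> X. (x, z) \<in> R \<circ>\<^sub>r S} \<in> v" if "{y \<in> X. (x, y) \<in> S} \<in> w" for x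
  proof -
    from that B have "{y \<in> X. (x, y) \<in> S} \<inter> {y \<in> X. {z \<in> X. (y, z) \<in> R} \<in> v} \<in> w"
      by (rule ultrafilter_on_Int[OF w])
    from ultrafilter_on_nonempty[OF w this]
    obtain y where "(x, y) \<in> S" "{z \<in> X. (y, z) \<in> R} \<in> v" by blast
    note \<open>{z \<in> X. (y, z) \<in> R} \<in> v\<close>
    moreover have "{z \<in> X. (y, z) \<in> R} \<subseteq> {z \<in> X. (x, z) \<in> R \<circ>\<^sub>r S}"
      using \<open>(x, y) \<in> S\<close> by auto
    ultimately show ?thesis
      by (rule ultrafilter_on_mono[OF v]) auto
  qed
  then have "{x \<in> X. {y \<in> X. (x, y) \<in> S} \<in> w} \<subseteq> {x \<in> X. {z \<in> X. (x, z) \<in> R \<circ>\<^sub>r S} \<in> v}"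
    by auto
  then have "{x \<in> X. {z \<in> X. (x, z) \<in> R \<circ>\<^sub>r S} \<in> v} \<in> u"
    by (rule ultrafilter_on_mono[OF u A]) auto
  with u v show "(u, v) \<in> tilde_ext X (R \<circ>\<^sub>r S)"
    unfolding tilde_ext_iff by blast
qed

section \<open>The star extension\<close>

lemma star_ext_iff:
  "(u, v) \<in> star_ext X R \<longleftrightarrow>
     ultrafilter_on X u \<and> ultrafilter_on X v \<and> (\<forall>A\<in>u. \<forall>B\<in>v. \<exists>x\<in>A. \<exists>y\<in>B. (x, y) \<in> R)"
proof -
  have "{x \<in> X. \<exists>y\<in>B. (x, y) \<in> R} \<in> u \<longleftrightarrow> (\<forall>A\<in>u. \<exists>x\<in>A. \<exists>y\<in>B. (x, y) \<in> R)"
    if u: "ultrafilter_on X u" for B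
  proof -
    have "{x \<in> X. \<exists>y\<in>B. (x, y) \<in> R} \<in> u \<longleftrightarrow>
        (\<forall>A\<in>u. {x \<in> X. \<exists>y\<in>B. (x, y) \<in> R} \<inter> A \<noteq> {})"
      by (rule ultrafilter_on_mem_iff_meets[OF u]) auto
    also have "\<dots> \<longleftrightarrow> (\<forall>A\<in>u. \<exists>x\<in>A. \<exists>y\<in>B. (x, y) \<in> R)"
    proof (rule ball_cong)
      fix A assume "A \<in> u"
      then have "A \<subseteq> X" by (rule ultrafilter_on_subset[OF u])
      then show "{x \<in> X. \<exists>y\<in>B. (x, y) \<in> R} \<inter> A \<noteq> {} \<longleftrightarrow> (\<exists>x\<in>A. \<exists>y\<in>B. (x, y) \<in> R)"
        by blast
    qed simp
    finally show ?thesis .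
  qed
  then show ?thesis
    unfolding star_ext_def ultrafilters_def by auto
qed

lemma star_ext_mono: "R \<subseteq> S \<Longrightarrow> star_ext X R \<subseteq> star_ext X S"
  by (rule subrelI) (simp add: star_ext_iff, blast)

lemma star_ext_converse: "(star_ext X R)\<inverse> = star_ext X (R\<inverse>)"
proof -
  have "(v, u) \<in> (star_ext X R)\<inverse> \<longleftrightarrow> (v, u) \<in> star_ext X (R\<inverse>)" for u v
    unfolding converse_iff star_ext_iff by blast
  then show ?thesis by auto
qed

lemma star_ext_Un: "star_ext X (R \<union> S) = star_ext X R \<union> star_ext X S"
proof
  show "star_ext X (R \<union> S) \<subseteq> star_ext X R \<union> star_ext X S"
  proof (rule subrelI, rule ccontr)
    fix u v assume uv: "(u, v) \<in> star_ext X (R \<union> S)"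
      and notin: "(u, v) \<notin> star_ext X R \<union> star_ext X S"
    from uv have u: "ultrafilter_on X u" and v: "ultrafilter_on X v"
      and meets: "\<And>A B. A \<in> u \<Longrightarrow> B \<in> v \<Longrightarrow> \<exists>x\<in>A. \<exists>y\<in>B. (x, y) \<in> R \<union> S"
      unfolding star_ext_iff by auto
    from notin u v obtain A B where AB: "A \<in> u" "B \<in> v" "\<And>x y. x \<in> A \<Longrightarrow> y \<in> B \<Longrightarrow> (x, y) \<notin> R"
      unfolding Un_iff star_ext_iff by blast
    from notin u v obtain C D where CD: "C \<in> u" "D \<in> v" "\<And>x y. x \<in> C \<Longrightarrow> y \<in> D \<Longrightarrow> (x, y) \<notin> S"
      unfolding Un_iff star_ext_iff by blast
    have "A \<inter> C \<in> u" "B \<inter> D \<in> v"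
      using AB CD u v by (auto intro: ultrafilter_on_Int)
    from meets[OF this] AB(3) CD(3) show False by blast
  qed
  show "star_ext X R \<union> star_ext X S \<subseteq> star_ext X (R \<union> S)"
    by (simp add: star_ext_mono)
qed

lemma star_ext_Int: "star_ext X (R \<inter> S) \<subseteq> star_ext X R \<inter> star_ext X S"
  by (simp add: star_ext_mono)

lemma star_ext_Compl:
  "ultrafilters X \<times> ultrafilters X - star_ext X R \<subseteq> star_ext X (X \<times> X - R)"
proof (rule subrelI)
  fix u v assume uv: "(u, v) \<in> ultrafilters X \<times> ultrafilters X - star_ext X R"
  then have u: "ultrafilter_on X u" and v: "ultrafilter_on X v"
    unfolding ultrafilters_def by auto
  with uv obtain A B where AB: "A \<in> u" "B \<in> v" "\<And>x y. x \<in> A \<Longrightarrow> y \<in> B \<Longrightarrow> (x, y) \<notin> R"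
    unfolding Diff_iff star_ext_iff by blast
  have "\<exists>x\<in>C. \<exists>y\<in>D. (x, y) \<in> X \<times> X - R" if "C \<in> u" "D \<in> v" for C D
  proof -
    have "A \<inter> C \<in> u" "B \<inter> D \<in> v"
      using AB that u v by (auto intro: ultrafilter_on_Int)
    then obtain x y where "x \<in> A \<inter> C" "y \<in> B \<inter> D"
      using ultrafilter_on_nonempty u v by blast
    moreover have "A \<subseteq> X" "B \<subseteq> X"
      using AB ultrafilter_on_subset u v by blast+
    ultimately show ?thesis using AB(3) by blast
  qed
  with u v show "(u, v) \<in> star_ext X (X \<times> X - R)"
    unfolding star_ext_iff by blast
qed

lemma star_ext_comp:
  assumes "S \<subseteq> X \<times> X"
  shows "star_ext X (R \<circ>\<^sub>r S) = star_ext X R \<circ>\<^sub>r star_ext X S"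
proof
  show "star_ext X (R \<circ>\<^sub>r S) \<subseteq> star_ext X R \<circ>\<^sub>r star_ext X S"
  proof (rule subrelI)
    fix u v assume "(u, v) \<in> star_ext X (R \<circ>\<^sub>r S)"
    then have u: "ultrafilter_on X u" and v: "ultrafilter_on X v"
      and meets: "\<And>A B. A \<in> u \<Longrightarrow> B \<in> v \<Longrightarrow> \<exists>x\<in>A. \<exists>z\<in>B. (x, z) \<in> R \<circ>\<^sub>r S"
      unfolding star_ext_iff by auto
    \<comment> \<open>Members of \<open>w\<close> must meet \<open>S[A]\<close> for all \<open>A \<in> u\<close> and \<open>R\<inverse>[B]\<close> for all \<open>B \<in> v\<close>.\<close>
    let ?\<B> = "{S `` A \<inter> R\<inverse> `` B | A B. A \<in> u \<and> B \<in> v}"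
    have in_base: "S `` A \<inter> R\<inverse> `` B \<in> ?\<B>" if "A \<in> u" "B \<in> v" for A B
      using that by blast
    have "\<exists>G\<in>?\<B>. G \<subseteq> E \<inter> F" if "E \<in> ?\<B>" "F \<in> ?\<B>" for E F
    proof -
      from that obtain A B C D where *: "A \<in> u" "B \<in> v" "E = S `` A \<inter> R\<inverse> `` B"
        "C \<in> u" "D \<in> v" "F = S `` C \<inter> R\<inverse> `` D" by blast
      then have "A \<inter> C \<in> u" "B \<inter> D \<in> v"
        using u v by (auto intro: ultrafilter_on_Int)
      note in_base[OF this]
      moreover have "S `` (A \<inter> C) \<inter> R\<inverse> `` (B \<inter> D) \<subseteq> E \<inter> F"
        unfolding * by blast
      ultimately show ?thesis by blast
    qed
    moreover have "{} \<notin> ?\<B>"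
    proof
      assume "{} \<in> ?\<B>"
      then obtain A B where "A \<in> u" "B \<in> v" "S `` A \<inter> R\<inverse> `` B = {}" by auto
      with meets[of A B] show False by blast
    qed
    moreover have "?\<B> \<noteq> {}"
      using ultrafilter_on_carrier u v by blast
    moreover have "?\<B> \<subseteq> Pow X"
      using assms by blast
    ultimately obtain w where w: "ultrafilter_on X w" "?\<B> \<subseteq> w"
      by (rule_tac ultrafilter_extending_base[of ?\<B> X]) auto
    have base_meets: "S `` A \<inter> R\<inverse> `` B \<inter> C \<noteq> {}" if "A \<in> u" "B \<in> v" "C \<in> w" for A B C
    proof -
      have "S `` A \<inter> R\<inverse> `` B \<in> w"
        using in_base[OF that(1,2)] w(2) by blast
      then show ?thesis
        using ultrafilter_on_Int[OF w(1) _ that(3)] ultrafilter_on_nonempty[OF w(1)] by blast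
    qed
    have "\<exists>x\<in>A. \<exists>y\<in>C. (x, y) \<in> S" if "A \<in> u" "C \<in> w" for A C
      using base_meets[OF that(1) ultrafilter_on_carrier[OF v] that(2)] by blast
    moreover have "\<exists>y\<in>C. \<exists>z\<in>B. (y, z) \<in> R" if "C \<in> w" "B \<in> v" for B C
      using base_meets[OF ultrafilter_on_carrier[OF u] that(2,1)] by blast
    ultimately have "(u, w) \<in> star_ext X S" "(w, v) \<in> star_ext X R"
      unfolding star_ext_iff using u v w(1) by blast+
    then show "(u, v) \<in> star_ext X R \<circ>\<^sub>r star_ext X S" by blast
  qed
  show "star_ext X R \<circ>\<^sub>r star_ext X S \<subseteq> star_ext X (R \<circ>\<^sub>r S)"
  proof (rule subrelI)
    fix u v assume "(u, v) \<in> star_ext X R \<circ>\<^sub>r star_ext X S"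
    then obtain w where uw: "(u, w) \<in> star_ext X S" and wv: "(w, v) \<in> star_ext X R" by blast
    have "\<exists>x\<in>A. \<exists>z\<in>B. (x, z) \<in> R \<circ>\<^sub>r S" if "A \<in> u" "B \<in> v" for A B
    proof -
      have "{y \<in> X. \<exists>z\<in>B. (y, z) \<in> R} \<in> w"
        using wv that unfolding star_ext_def by blast
      with uw that obtain x y where "x \<in> A" "y \<in> {y \<in> X. \<exists>z\<in>B. (y, z) \<in> R}" "(x, y) \<in> S"
        unfolding star_ext_iff by blast
      then show ?thesis by blast
    qed
    with uw wv show "(u, v) \<in> star_ext X (R \<circ>\<^sub>r S)"
      by (simp add: star_ext_iff)
  qed
qed

section \<open>Counterexamples from free ultrafilters\<close>

lemma star_ext_Id_free:
  assumes u: "ultrafilter_on UNIV u" and free: "\<And>F. finite F \<Longrightarrow> F \<notin> u"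
  shows "(u, u) \<in> star_ext UNIV Id" and "(u, u) \<in> star_ext UNIV (- Id)"
proof -
  have common: "infinite (A \<inter> B)" if "A \<in> u" "B \<in> u" for A B
    using ultrafilter_on_Int[OF u that] free by blast
  have "\<exists>x\<in>A. \<exists>y\<in>B. (x, y) \<in> Id" if "A \<in> u" "B \<in> u" for A B
    using common[OF that] infinite_imp_nonempty by blast
  moreover have "\<exists>x\<in>A. \<exists>y\<in>B. (x, y) \<in> - Id" if AB: "A \<in> u" "B \<in> u" for A B
  proof -
    obtain x where x: "x \<in> A \<inter> B"
      using common[OF AB] infinite_imp_nonempty by blast
    have "infinite (A \<inter> B - {x})"
      using common[OF AB] by simp
    then obtain y where "y \<in> A \<inter> B - {x}"
      using infinite_imp_nonempty by blast
    with x show ?thesis by blast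
  qed
  ultimately show "(u, u) \<in> star_ext UNIV Id" "(u, u) \<in> star_ext UNIV (- Id)"
    unfolding star_ext_iff using u by blast+
qed

lemma star_ext_empty: "star_ext X {} = {}"
proof -
  have "(u, v) \<notin> star_ext X {}" for u v
    using ultrafilter_on_carrier[of X u] ultrafilter_on_carrier[of X v]
    unfolding star_ext_iff by blast
  then show ?thesis by auto
qed

lemma tilde_ext_Id_free:
  assumes free: "\<And>F. finite F \<Longrightarrow> F \<notin> u"
  shows "(u, v) \<notin> tilde_ext UNIV Id"
proof
  assume "(u, v) \<in> tilde_ext UNIV Id"
  then have v: "ultrafilter_on UNIV v" and mem: "{x. {x} \<in> v} \<in> u"
    by (auto simp: tilde_ext_iff)
  \<comment> \<open>Distinct singletons are disjoint, so at most one of them belongs to \<open>v\<close>.\<close>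
  have "x = y" if "{x} \<in> v" "{y} \<in> v" for x y
    using ultrafilter_on_Int[OF v that] ultrafilter_on_nonempty[OF v] by blast
  then have "\<exists>a. {x. {x} \<in> v} \<subseteq> {a}"
    by blast
  then have "finite {x. {x} \<in> v}"
    using finite_subset by blast
  with free mem show False by blast
qed

lemma tilde_ext_UNIV: "tilde_ext X UNIV = ultrafilters X \<times> ultrafilters X"
proof -
  have "{x \<in> X. {y \<in> X. (x, y) \<in> UNIV} \<in> v} = X" if "ultrafilter_on X v" for v
    using ultrafilter_on_carrier[OF that] by simp
  then show ?thesis
    using ultrafilter_on_carrier by (auto simp: tilde_ext_def ultrafilters_def)
qed

lemma free_ultrafilter_ray:
  assumes u: "ultrafilter_on UNIV (u :: nat set set)" and free: "\<And>F. finite F \<Longrightarrow> F \<notin> u"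
  shows "{x<..} \<in> u" "{x..} \<in> u"
proof -
  have "UNIV - {..x} \<in> u" "UNIV - {..<x} \<in> u"
    using ultrafilter_on_Diff_iff[OF u] free by auto
  moreover have "UNIV - {..x} = {x<..}" "UNIV - {..<x} = {x..}" by auto
  ultimately show "{x<..} \<in> u" "{x..} \<in> u" by simp_all
qed

text \<open>
  The relation below relates an even \<open>x\<close> to all but finitely many numbers and an odd \<open>x\<close> to
  finitely many only. Conversely, finitely many even numbers, but all except finitely many odd
  numbers, are related to a given number.
\<close>

lemma tilde_ext_parity_even:
  assumes u: "ultrafilter_on UNIV (u :: nat set set)" and free: "\<And>F. finite F \<Longrightarrow> F \<notin> u"
    and even: "{x. even x} \<in> u"
  defines "R \<equiv> {(x, y). x < y \<longleftrightarrow> even x}"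
  shows "(u, u) \<in> tilde_ext UNIV R" and "(u, u) \<notin> tilde_ext UNIV (R\<inverse>)"
proof -
  have "{y. (x, y) \<in> R} \<in> u" if "even x" for x
  proof -
    have "{y. (x, y) \<in> R} = {x<..}"
      using that by (auto simp: R_def)
    then show ?thesis using free_ultrafilter_ray(1)[OF u free] by simp
  qed
  then have "{x. even x} \<subseteq> {x. {y. (x, y) \<in> R} \<in> u}"
    by auto
  then have "{x. {y. (x, y) \<in> R} \<in> u} \<in> u"
    by (rule ultrafilter_on_mono[OF u even]) simp
  then show "(u, u) \<in> tilde_ext UNIV R"
    using u by (simp add: tilde_ext_iff)
  have "{y. (x, y) \<in> R\<inverse>} \<notin> u" for x
  proof
    assume "{y. (x, y) \<in> R\<inverse>} \<in> u"
    then have "{y. (x, y) \<in> R\<inverse>} \<inter> {y. even y} \<in> u"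
      using even by (rule ultrafilter_on_Int[OF u])
    moreover have "finite ({y. (x, y) \<in> R\<inverse>} \<inter> {y. even y})"
      by (rule finite_subset[of _ "{..<x}"]) (auto simp: R_def)
    ultimately show False using free by blast
  qed
  then have "{x. {y. (x, y) \<in> R\<inverse>} \<in> u} = {}" by blast
  then show "(u, u) \<notin> tilde_ext UNIV (R\<inverse>)"
    using free[of "{}"] by (simp add: tilde_ext_iff)
qed

lemma tilde_ext_parity_odd:
  assumes u: "ultrafilter_on UNIV (u :: nat set set)" and free: "\<And>F. finite F \<Longrightarrow> F \<notin> u"
    and odd: "{x. odd x} \<in> u"
  defines "R \<equiv> {(x, y). x < y \<longleftrightarrow> even x}"
  shows "(u, u) \<notin> tilde_ext UNIV R" and "(u, u) \<in> tilde_ext UNIV (R\<inverse>)"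
proof -
  have "{y. (x, y) \<in> R} \<notin> u" if "odd x" for x
  proof -
    have "{y. (x, y) \<in> R} = {..x}"
      using that by (auto simp: R_def)
    then show ?thesis using free by simp
  qed
  then have "{x. {y. (x, y) \<in> R} \<in> u} \<inter> {x. odd x} = {}" by blast
  then have "{x. {y. (x, y) \<in> R} \<in> u} \<notin> u"
    using ultrafilter_on_Int[OF u _ odd] free[of "{}"] by fastforce
  then show "(u, u) \<notin> tilde_ext UNIV R"
    by (simp add: tilde_ext_iff)
  have "{y. (x, y) \<in> R\<inverse>} \<in> u" for x
  proof -
    have "{x..} \<inter> {y. odd y} \<in> u"
      using free_ultrafilter_ray(2)[OF u free] odd by (rule ultrafilter_on_Int[OF u])
    then show ?thesis
      by (rule ultrafilter_on_mono[OF u]) (auto simp: R_def)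
  qed
  then have "{x. {y. (x, y) \<in> R\<inverse>} \<in> u} = UNIV" by blast
  then show "(u, u) \<in> tilde_ext UNIV (R\<inverse>)"
    using u ultrafilter_on_carrier[OF u] by (simp add: tilde_ext_iff)
qed

section \<open>The algebra of the two extensions\<close>

theorem theorem2:
  shows "(\<forall>(X :: 'a set) R S. R \<subseteq> X \<times> X \<and> S \<subseteq> X \<times> X \<longrightarrow>
            ultrafilters X \<times> ultrafilters X - tilde_ext X R = tilde_ext X (X \<times> X - R) \<and>
            tilde_ext X (R \<union> S) = tilde_ext X R \<union> tilde_ext X S \<and>
            tilde_ext X (R \<inter> S) = tilde_ext X R \<inter> tilde_ext X S \<and>
            (star_ext X R)\<inverse> = star_ext X (R\<inverse>) \<and>
            star_ext X (R \<union> S) = star_ext X R \<union> star_ext X S \<and>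
            star_ext X (R \<circ>\<^sub>r S) = star_ext X R \<circ>\<^sub>r star_ext X S \<and>
            ultrafilters X \<times> ultrafilters X - star_ext X R \<subseteq> star_ext X (X \<times> X - R) \<and>
            star_ext X (R \<inter> S) \<subseteq> star_ext X R \<inter> star_ext X S \<and>
            tilde_ext X R \<circ>\<^sub>r tilde_ext X S \<subseteq> tilde_ext X (R \<circ>\<^sub>r S))
       \<and> (\<exists>(X :: nat set) R. R \<subseteq> X \<times> X \<and>
            ultrafilters X \<times> ultrafilters X - star_ext X R \<subset> star_ext X (X \<times> X - R))
       \<and> (\<exists>(X :: nat set) R S. R \<subseteq> X \<times> X \<and> S \<subseteq> X \<times> X \<and>
            star_ext X (R \<inter> S) \<subset> star_ext X R \<inter> star_ext X S)
       \<and> (\<exists>(X :: nat set) R S. R \<subseteq> X \<times> X \<and> S \<subseteq> X \<times> X \<and>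
            tilde_ext X R \<circ>\<^sub>r tilde_ext X S \<subset> tilde_ext X (R \<circ>\<^sub>r S))
       \<and> (\<exists>(X :: nat set) R. R \<subseteq> X \<times> X \<and>
            \<not> (tilde_ext X R)\<inverse> \<subseteq> tilde_ext X (R\<inverse>) \<and>
            \<not> tilde_ext X (R\<inverse>) \<subseteq> (tilde_ext X R)\<inverse>)"
proof (intro conjI)
  show "\<forall>(X :: 'a set) R S. R \<subseteq> X \<times> X \<and> S \<subseteq> X \<times> X \<longrightarrow>
            ultrafilters X \<times> ultrafilters X - tilde_ext X R = tilde_ext X (X \<times> X - R) \<and>
            tilde_ext X (R \<union> S) = tilde_ext X R \<union> tilde_ext X S \<and>
            tilde_ext X (R \<inter> S) = tilde_ext X R \<inter> tilde_ext X S \<and>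
            (star_ext X R)\<inverse> = star_ext X (R\<inverse>) \<and>
            star_ext X (R \<union> S) = star_ext X R \<union> star_ext X S \<and>
            star_ext X (R \<circ>\<^sub>r S) = star_ext X R \<circ>\<^sub>r star_ext X S \<and>
            ultrafilters X \<times> ultrafilters X - star_ext X R \<subseteq> star_ext X (X \<times> X - R) \<and>
            star_ext X (R \<inter> S) \<subseteq> star_ext X R \<inter> star_ext X S \<and>
            tilde_ext X R \<circ>\<^sub>r tilde_ext X S \<subseteq> tilde_ext X (R \<circ>\<^sub>r S)"
    by (intro allI impI conjI tilde_ext_Compl tilde_ext_Un tilde_ext_Int star_ext_converse
        star_ext_Un star_ext_comp star_ext_Compl star_ext_Int tilde_ext_comp) simp
next
  obtain u :: "nat set set" where u: "ultrafilter_on UNIV u" and free: "\<And>F. finite F \<Longrightarrow> F \<notin> u"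
    using free_ultrafilter[OF infinite_UNIV_nat] by blast
  note Id = star_ext_Id_free[OF u free]
  have compl: "UNIV \<times> UNIV - Id = - (Id :: (nat \<times> nat) set)" by auto

  have "ultrafilters UNIV \<times> ultrafilters UNIV - star_ext UNIV Id
          \<subset> star_ext (UNIV :: nat set) (UNIV \<times> UNIV - Id)"
    using star_ext_Compl[of "UNIV :: nat set" Id] Id unfolding compl by blast
  then show "\<exists>(X :: nat set) R. R \<subseteq> X \<times> X \<and>
            ultrafilters X \<times> ultrafilters X - star_ext X R \<subset> star_ext X (X \<times> X - R)"
    by (rule_tac exI[of _ UNIV], rule_tac exI[of _ Id]) simp

  have "star_ext UNIV (Id \<inter> - Id) \<subset> star_ext (UNIV :: nat set) Id \<inter> star_ext UNIV (- Id)"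
    using Id star_ext_empty by auto
  then show "\<exists>(X :: nat set) R S. R \<subseteq> X \<times> X \<and> S \<subseteq> X \<times> X \<and>
            star_ext X (R \<inter> S) \<subset> star_ext X R \<inter> star_ext X S"
    by (rule_tac exI[of _ UNIV], rule_tac exI[of _ Id], rule_tac exI[of _ "- Id"]) simp

  have "(u, u) \<notin> tilde_ext UNIV UNIV \<circ>\<^sub>r tilde_ext UNIV Id"
    using tilde_ext_Id_free[OF free] by blast
  moreover have "(u, u) \<in> tilde_ext UNIV (UNIV \<circ>\<^sub>r Id)"
    using u by (simp add: tilde_ext_UNIV ultrafilters_def)
  ultimately have "tilde_ext UNIV UNIV \<circ>\<^sub>r tilde_ext UNIV Id
          \<subset> tilde_ext (UNIV :: nat set) (UNIV \<circ>\<^sub>r Id)"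
    using tilde_ext_comp[where X = "UNIV :: nat set" and R = UNIV and S = Id] by blast
  then show "\<exists>(X :: nat set) R S. R \<subseteq> X \<times> X \<and> S \<subseteq> X \<times> X \<and>
            tilde_ext X R \<circ>\<^sub>r tilde_ext X S \<subset> tilde_ext X (R \<circ>\<^sub>r S)"
    by (rule_tac exI[of _ UNIV], rule_tac exI[of _ UNIV], rule_tac exI[of _ Id]) simp
next
  have "infinite (range (\<lambda>n :: nat. 2 * n))" "infinite (range (\<lambda>n :: nat. 2 * n + 1))"
    by (simp_all add: finite_image_iff inj_on_def)
  moreover have "range (\<lambda>n :: nat. 2 * n) \<subseteq> {x. even x}" "range (\<lambda>n :: nat. 2 * n + 1) \<subseteq> {x. odd x}"
    by auto
  ultimately have infinite_parity: "infinite {x :: nat. even x}" "infinite {x :: nat. odd x}"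
    using finite_subset by blast+
  obtain u :: "nat set set"
    where u: "ultrafilter_on UNIV u" "\<And>F. finite F \<Longrightarrow> F \<notin> u" "{x. even x} \<in> u"
    using free_ultrafilter[OF infinite_parity(1)] by blast
  obtain w :: "nat set set"
    where w: "ultrafilter_on UNIV w" "\<And>F. finite F \<Longrightarrow> F \<notin> w" "{x. odd x} \<in> w"
    using free_ultrafilter[OF infinite_parity(2)] by blast
  define R :: "(nat \<times> nat) set" where "R = {(x, y). x < y \<longleftrightarrow> even x}"
  have "(u, u) \<in> (tilde_ext UNIV R)\<inverse> - tilde_ext UNIV (R\<inverse>)"
    using tilde_ext_parity_even[OF u] unfolding R_def by simp
  moreover have "(w, w) \<in> tilde_ext UNIV (R\<inverse>) - (tilde_ext UNIV R)\<inverse>"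
    using tilde_ext_parity_odd[OF w] unfolding R_def by simp
  ultimately show "\<exists>(X :: nat set) R. R \<subseteq> X \<times> X \<and>
            \<not> (tilde_ext X R)\<inverse> \<subseteq> tilde_ext X (R\<inverse>) \<and>
            \<not> tilde_ext X (R\<inverse>) \<subseteq> (tilde_ext X R)\<inverse>"
    by (rule_tac exI[of _ UNIV], rule_tac exI[of _ R]) auto
qed

end
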